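(* Let $\psi:(0,\infty)\to(0,\infty)$ be continuous, non-decreasing and subadditive, with $\lim_{t\to0^+}\psi(t)=0$, and suppose that $\limsup_{t\to0^+}\frac{\psi(t)}{t}<\infty$. Define $\gamma:[0,\infty)\to[0,\infty)$ by $\gamma(0)=0$ and $\gamma(t)=\psi(t)$ for $t>0$. Then the $\gamma$-density topology is finer than the $\psi$-density topology, i.e. $\tau_\psi\subset\tau_\gamma$.
   Context: $|\cdot|$ denotes Lebesgue measure on $\mathbb{R}$, $\mathcal{L}$ the family of Lebesgue measurable subsets of $\mathbb{R}$, and $A^c=\mathbb{R}\setminus A$. For $A\in\mathcal{L}$, $\Phi_\psi(A)$ is the set of $\psi$-density points of $A$, i.e. of all $x\in\mathbb{R}$ with $\lim_{\alpha\to0^+}\frac{|A^c\cap(x-\alpha,x+\alpha)|}{2\alpha\,\psi(2\alpha)}=0$, and $\mathcal{D}_\gamma(A)$ is the set of $\gamma$-density points of $A$, i.e. of all $x\in\mathbb{R}$ with $\lim_{\alpha\to 0^+}\frac{\gamma(|(x-\alpha,x+\alpha)\cap A^c|)}{\gamma(2\alpha)}=0$. Set $\tau_\psi=\{A\in\mathcal{L}:A\subset\Phi_\psi(A)\}$ and $\tau_\gamma=\{A\in\mathcal{L}:A\subset\mathcal{D}_\gamma(A)\}$. "Finer" is meant in the non-strict sense. *)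

theory Defs
  imports "HOL-Analysis.Analysis"
begin

text \<open>
  Functions on \<open>(0,\<infinity>)\<close> or \<open>[0,\<infinity>)\<close> are total functions on \<^typ>\<open>real\<close>; the definitions below
  never evaluate \<open>\<psi>\<close> outside \<open>(0,\<infinity>)\<close> nor \<open>\<gamma>\<close> outside \<open>[0,\<infinity>)\<close>, apart from the irrelevant
  values at \<open>\<alpha> \<le> 0\<close>, which the filter \<open>at_right 0\<close> ignores. The real-valued measure is
  harmless because it is only applied to subsets of bounded intervals.
\<close>

definition psi_density_points :: "(real \<Rightarrow> real) \<Rightarrow> real set \<Rightarrow> real set" where
  "psi_density_points \<psi> A =
     {x. ((\<lambda>\<alpha>. measure lebesgue ((- A) \<inter> {x - \<alpha><..<x + \<alpha>}) / (2 * \<alpha> * \<psi> (2 * \<alpha>)))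
           \<longlongrightarrow> 0) (at_right 0)}"

definition gamma_density_points :: "(real \<Rightarrow> real) \<Rightarrow> real set \<Rightarrow> real set" where
  "gamma_density_points \<gamma> A =
     {x. ((\<lambda>\<alpha>. \<gamma> (measure lebesgue ({x - \<alpha><..<x + \<alpha>} \<inter> (- A))) / \<gamma> (2 * \<alpha>))
           \<longlongrightarrow> 0) (at_right 0)}"

definition psi_density_topology :: "(real \<Rightarrow> real) \<Rightarrow> real set set" where
  "psi_density_topology \<psi> = {A. A \<in> sets lebesgue \<and> A \<subseteq> psi_density_points \<psi> A}"

definition gamma_density_topology :: "(real \<Rightarrow> real) \<Rightarrow> real set set" where
  "gamma_density_topology \<gamma> = {A. A \<in> sets lebesgue \<and> A \<subseteq> gamma_density_points \<gamma> A}"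

end

theory Submission imports Defs begin

text \<open>
  Write \<open>m(\<alpha>)\<close> for the measure of the part of the complement of \<open>A\<close> in \<open>(x - \<alpha>, x + \<alpha>)\<close>.
  The bound on the upper limit gives \<open>\<psi> t \<le> C t\<close> for all small \<open>t > 0\<close>. As \<open>m(\<alpha>) \<le> 2 \<alpha>\<close> is
  small together with \<open>\<alpha>\<close>, this bound applies at \<open>t = m(\<alpha>)\<close> and yields
  \<open>\<gamma> (m(\<alpha>)) / \<gamma> (2 \<alpha>) \<le> C m(\<alpha>) / \<psi> (2 \<alpha>) = 2 C \<alpha> \<cdot> (m(\<alpha>) / (2 \<alpha> \<psi> (2 \<alpha>)))\<close>.
  If \<open>x\<close> is a \<open>\<psi>\<close>-density point, then the last factor tends to \<open>0\<close>, hence so does the product.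
  So every \<open>\<psi>\<close>-density point of a measurable set is a \<open>\<gamma>\<close>-density point of it, which is more
  than the inclusion of the topologies asks for.
\<close>

lemma linear_bound_of_Limsup_at_right_0:
  fixes f :: "real \<Rightarrow> real"
  assumes "Limsup (at_right 0) (\<lambda>t. ereal (f t / t)) < \<infinity>"
  obtains C \<delta> where "C > 0" "\<delta> > 0" "\<And>t. 0 < t \<Longrightarrow> t < \<delta> \<Longrightarrow> f t \<le> C * t"
proof -
  from assms obtain B where "Limsup (at_right 0) (\<lambda>t. ereal (f t / t)) < ereal B"
    using ereal_dense2 by blast
  then have "eventually (\<lambda>t. f t / t < B) (at_right 0)"
    by (auto dest: Limsup_lessD)
  then obtain \<delta> where "\<delta> > 0" and B: "\<And>t. 0 < t \<Longrightarrow> t < \<delta> \<Longrightarrow> f t / t < B"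
    by (auto simp: eventually_at_right_field)
  have "f t \<le> max 1 B * t" if "0 < t" "t < \<delta>" for t
  proof -
    have "f t / t \<le> max 1 B"
      using B[OF that] by simp
    with \<open>0 < t\<close> show ?thesis
      by (simp add: pos_divide_le_eq)
  qed
  with \<open>\<delta> > 0\<close> show thesis
    by (intro that[of "max 1 B" \<delta>]) auto
qed

lemma measure_lebesgue_Int_symmetric_interval_le:
  fixes x \<alpha> :: real
  assumes "A \<in> sets lebesgue" "\<alpha> \<ge> 0"
  shows "measure lebesgue ({x - \<alpha><..<x + \<alpha>} \<inter> A) \<le> 2 * \<alpha>"
proof -
  have "measure lebesgue ({x - \<alpha><..<x + \<alpha>} \<inter> A) \<le> measure lebesgue {x - \<alpha><..<x + \<alpha>}"
    using assms by (intro measure_mono_fmeasurable) auto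
  also have "\<dots> = 2 * \<alpha>"
    using assms by simp
  finally show ?thesis .
qed

lemma psi_density_points_subset_gamma_density_points:
  fixes \<psi> \<gamma> :: "real \<Rightarrow> real"
  assumes A: "A \<in> sets lebesgue"
    and pos: "\<And>t. t > 0 \<Longrightarrow> \<psi> t > 0"
    and limsup: "Limsup (at_right 0) (\<lambda>t. ereal (\<psi> t / t)) < \<infinity>"
    and \<gamma>0: "\<gamma> 0 = 0"
    and \<gamma>\<psi>: "\<And>t. t > 0 \<Longrightarrow> \<gamma> t = \<psi> t"
  shows "psi_density_points \<psi> A \<subseteq> gamma_density_points \<gamma> A"
proof
  fix x assume "x \<in> psi_density_points \<psi> A"
  define m where "m = (\<lambda>\<alpha>. measure lebesgue ({x - \<alpha><..<x + \<alpha>} \<inter> (- A)))"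
  have \<psi>_density: "((\<lambda>\<alpha>. m \<alpha> / (2 * \<alpha> * \<psi> (2 * \<alpha>))) \<longlongrightarrow> 0) (at_right 0)"
    using \<open>x \<in> psi_density_points \<psi> A\<close>
    by (simp add: psi_density_points_def m_def Int_commute)
  obtain C \<delta> where "C > 0" "\<delta> > 0" and C: "\<And>t. 0 < t \<Longrightarrow> t < \<delta> \<Longrightarrow> \<psi> t \<le> C * t"
    using linear_bound_of_Limsup_at_right_0[OF limsup] by blast
  have bounds: "0 \<le> \<gamma> (m \<alpha>) / \<gamma> (2 * \<alpha>) \<and>
      \<gamma> (m \<alpha>) / \<gamma> (2 * \<alpha>) \<le> 2 * C * \<alpha> * (m \<alpha> / (2 * \<alpha> * \<psi> (2 * \<alpha>)))"
    if "0 < \<alpha>" "\<alpha> < \<delta> / 2" for \<alpha>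
  proof -
    have m: "0 \<le> m \<alpha>" "m \<alpha> < \<delta>"
      using measure_lebesgue_Int_symmetric_interval_le[of "- A" \<alpha> x] A that
      by (auto simp: m_def Compl_in_sets_lebesgue)
    have "0 < \<psi> (2 * \<alpha>)"
      using pos that by simp
    \<comment> \<open>For \<open>m \<alpha> = 0\<close> both inequalities come from \<open>\<gamma> 0 = 0\<close>; the linear bound
      concerns only positive arguments.\<close>
    have "0 \<le> \<gamma> (m \<alpha>) \<and> \<gamma> (m \<alpha>) \<le> C * m \<alpha>"
      using m C[of "m \<alpha>"] pos[of "m \<alpha>"] \<gamma>\<psi>[of "m \<alpha>"] \<gamma>0 by (cases "m \<alpha> = 0") auto
    moreover have "2 * C * \<alpha> * (m \<alpha> / (2 * \<alpha> * \<psi> (2 * \<alpha>))) = C * m \<alpha> / \<psi> (2 * \<alpha>)"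
      using that by simp
    ultimately show ?thesis
      using \<gamma>\<psi>[of "2 * \<alpha>"] that \<open>0 < \<psi> (2 * \<alpha>)\<close> by (simp add: divide_right_mono)
  qed
  have near: "eventually (\<lambda>\<alpha>. 0 < \<alpha> \<and> \<alpha> < \<delta> / 2) (at_right 0)"
    using \<open>\<delta> > 0\<close> by (auto simp: eventually_at_right_field intro!: exI[of _ "\<delta> / 2"])
  have "((\<lambda>\<alpha>. 2 * C * \<alpha>) \<longlongrightarrow> 2 * C * 0) (at_right 0)"
    by (intro tendsto_intros)
  from tendsto_mult[OF this \<psi>_density]
  have majorant: "((\<lambda>\<alpha>. 2 * C * \<alpha> * (m \<alpha> / (2 * \<alpha> * \<psi> (2 * \<alpha>)))) \<longlongrightarrow> 0) (at_right 0)"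
    by (simp only: mult_zero_right)
  have "((\<lambda>\<alpha>. \<gamma> (m \<alpha>) / \<gamma> (2 * \<alpha>)) \<longlongrightarrow> 0) (at_right 0)"
    by (rule tendsto_sandwich[OF _ _ tendsto_const majorant];
        rule eventually_mono[OF near]; use bounds in blast)
  then show "x \<in> gamma_density_points \<gamma> A"
    by (simp add: gamma_density_points_def m_def)
qed

theorem theorem11:
  fixes \<psi> \<gamma> :: "real \<Rightarrow> real"
  assumes "\<And>t. t > 0 \<Longrightarrow> \<psi> t > 0"
    and "continuous_on {0<..} \<psi>"
    and "mono_on {0<..} \<psi>"
    and "\<And>s t. s > 0 \<Longrightarrow> t > 0 \<Longrightarrow> \<psi> (s + t) \<le> \<psi> s + \<psi> t"
    and "(\<psi> \<longlongrightarrow> 0) (at_right 0)"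
    and "Limsup (at_right 0) (\<lambda>t. ereal (\<psi> t / t)) < \<infinity>"
    and "\<gamma> 0 = 0"
    and "\<And>t. t > 0 \<Longrightarrow> \<gamma> t = \<psi> t"
  shows "psi_density_topology \<psi> \<subseteq> gamma_density_topology \<gamma>"
  using psi_density_points_subset_gamma_density_points[of _ \<psi> \<gamma>] assms(1,6-8)
  unfolding psi_density_topology_def gamma_density_topology_def by blast

end
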